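(* For $|q|<1$, $$\mathrm{C}\Phi_4(q)=\frac{1}{(q;q)_\infty^4}\Big(\Theta_3^3(q^2)+3\Theta_3(q^2)\Theta_2^2(q^2)\Big)=\frac{\Theta_3^4(q)}{(q;q)_\infty^4\Theta_3(q^2)}+\frac{\Theta_3^2(-q)\Theta_2^2(q^2)}{(q;q)_\infty^4\Theta_3(q^2)}.$$
   Context: A $k$-colored generalized Frobenius symbol is a two-row array with $d\ge 0$ columns whose entries are colored nonnegative integers $\ell_c$ ($\ell\ge 0$, color $c\in\{1,\dots,k\}$), each row strictly decreasing with respect to the total order $0_1\prec 0_2\prec\cdots\prec 0_k\prec 1_1\prec\cdots\prec 1_k\prec 2_1\prec\cdots$. It is a $k$-colored generalized Frobenius partition of $n=d+\sum(\text{integer values of all entries})$. $c\phi_k(n)$ is the number of such partitions of $n$ (with $c\phi_k(0)=1$), and $\mathrm{C}\Phi_k(q)=\sum_{n\ge0}c\phi_k(n)q^n$. $(a;q)_\infty=\prod_{j\ge1}(1-aq^{j-1})$, $\Theta_3(x)=\sum_{j\in\mathbf Z}x^{j^2}$ and $\Theta_2(x)=\sum_{j\in\mathbf Z}x^{(j+1/2)^2}$. *)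

theory Defs
  imports "HOL-Analysis.Analysis"
begin

text \<open>The pair \<open>(l, c)\<close> stands for the coloured integer \<open>l\<^sub>c\<close>.\<close>

type_synonym colored = "nat \<times> nat"

definition colored_less :: "colored \<Rightarrow> colored \<Rightarrow> bool" (infix "\<prec>\<^sub>c" 50) where
  "x \<prec>\<^sub>c y \<longleftrightarrow> fst x < fst y \<or> (fst x = fst y \<and> snd x < snd y)"

definition frobenius_row :: "nat \<Rightarrow> colored list \<Rightarrow> bool" where
  "frobenius_row k r \<longleftrightarrow> (\<forall>x\<in>set r. snd x \<in> {1..k}) \<and> sorted_wrt (\<lambda>x y. y \<prec>\<^sub>c x) r"

definition frobenius_symbols :: "nat \<Rightarrow> (colored list \<times> colored list) set" where
  "frobenius_symbols k =
     {(r, s). frobenius_row k r \<and> frobenius_row k s \<and> length r = length s}"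

definition frobenius_size :: "colored list \<times> colored list \<Rightarrow> nat" where
  "frobenius_size F =
     length (fst F) + sum_list (map fst (fst F)) + sum_list (map fst (snd F))"

definition cphi :: "nat \<Rightarrow> nat \<Rightarrow> nat" where
  "cphi k n = card {F \<in> frobenius_symbols k. frobenius_size F = n}"

definition CPhi :: "nat \<Rightarrow> complex \<Rightarrow> complex" where
  "CPhi k q = (\<Sum>n. of_nat (cphi k n) * q ^ n)"

definition qpoch_inf :: "complex \<Rightarrow> complex \<Rightarrow> complex" where
  "qpoch_inf a q = (\<Prod>j. 1 - a * q ^ j)"

definition Theta3 :: "complex \<Rightarrow> complex" where
  "Theta3 x = (\<Sum>\<^sub>\<infinity>j::int. x powi (j\<^sup>2))"

text \<open>
  \<open>\<Theta>\<^sub>2(x)\<close> is the sum of \<open>x\<close> to the powers \<open>(j + 1/2)\<^sup>2 = (2 j + 1)\<^sup>2 / 4\<close>, so it depends on a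
  choice of \<open>x\<close> to the power \<open>1/4\<close>. \<open>Theta2_root w\<close> is \<open>\<Theta>\<^sub>2(w\<^sup>4)\<close>, computed with \<open>w\<close> as that fourth
  root. In \<open>\<Theta>\<^sub>2(q\<^sup>2)\<close> the powers are powers of \<open>q\<close> to the power \<open>1/2\<close>: the fourth root of \<open>q\<^sup>2\<close> is a
  square root of \<open>q\<close>. The principal branch of the fourth root of \<open>q\<^sup>2\<close> is not one if \<open>Re q < 0\<close>.
\<close>

definition Theta2_root :: "complex \<Rightarrow> complex" where
  "Theta2_root w = (\<Sum>\<^sub>\<infinity>j::int. w powi ((2 * j + 1)\<^sup>2))"

lemma Theta2_root_principal:
  "Theta2_root (x powr (1/4)) = (\<Sum>\<^sub>\<infinity>j::int. x powr ((of_int j + 1/2)\<^sup>2))"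
  unfolding Theta2_root_def
proof (rule infsum_cong)
  fix j :: int
  have nz: "2 * j + 1 \<noteq> 0" by presburger
  have nz': "(of_int j + 1/2 :: complex) \<noteq> 0"
  proof
    assume "(of_int j + 1/2 :: complex) = 0"
    then have "(of_int (2 * j + 1) :: complex) = 0" by (simp add: field_simps)
    with nz show False by (metis of_int_eq_0_iff)
  qed
  show "(x powr (1/4)) powi ((2 * j + 1)\<^sup>2) = x powr ((of_int j + 1/2)\<^sup>2)"
  proof (cases "x = 0")
    case True
    then show ?thesis using nz nz' by (simp add: power_int_0_left_if)
  next
    case False
    have "(x powr (1/4)) powi ((2 * j + 1)\<^sup>2) = exp (of_int ((2 * j + 1)\<^sup>2) * (1/4 * ln x))"
      using False by (simp only: powr_def exp_power_int if_False)
    also have "of_int ((2 * j + 1)\<^sup>2) * (1/4 * ln x) = (of_int j + 1/2)\<^sup>2 * ln x"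
      by (simp add: power2_eq_square field_simps)
    finally show ?thesis using False by (simp add: powr_def)
  qed
qed

lemma finite_frobenius_symbols_of_size:
  "finite {F \<in> frobenius_symbols k. frobenius_size F = n}"
proof (rule finite_subset)
  let ?R = "{r. set r \<subseteq> {..n} \<times> {..k} \<and> length r \<le> n}"
  show "finite (?R \<times> ?R)"
    by (intro finite_cartesian_product finite_lists_length_le) auto
  show "{F \<in> frobenius_symbols k. frobenius_size F = n} \<subseteq> ?R \<times> ?R"
  proof
    fix F assume F: "F \<in> {F \<in> frobenius_symbols k. frobenius_size F = n}"
    obtain r s where rs: "F = (r, s)" by (cases F)
    have sz: "length r + sum_list (map fst r) + sum_list (map fst s) = n"
      and len: "length s = length r"
      and col: "\<forall>x\<in>set r \<union> set s. snd x \<le> k"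
      using F by (auto simp: rs frobenius_symbols_def frobenius_size_def frobenius_row_def)
    have val: "fst x \<le> n" if "x \<in> set r \<union> set s" for x
    proof -
      have "fst x \<le> sum_list (map fst r) \<or> fst x \<le> sum_list (map fst s)"
        using that by (auto intro!: member_le_sum_list)
      with sz show ?thesis by linarith
    qed
    have "set r \<union> set s \<subseteq> {..n} \<times> {..k}"
      using val col by (force simp: mem_Times_iff)
    then show "F \<in> ?R \<times> ?R" using sz len by (simp add: rs)
  qed
qed

lemma cphi_0: "cphi k 0 = 1"
proof -
  have "{F \<in> frobenius_symbols k. frobenius_size F = 0} = {([], [])}"
    by (auto simp: frobenius_symbols_def frobenius_size_def frobenius_row_def)
  then show ?thesis by (simp add: cphi_def)
qed

end

theory Submission
  imports Defs
begin

text \<open>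
  Splitting both rows of a Frobenius symbol by colour turns it into \<open>k\<close> pairs \<open>(R, S)\<close> of finite sets
  of naturals (Maya diagrams) whose charges \<open>|R| - |S|\<close> add up to \<open>0\<close>. Shifting a diagram of charge
  \<open>0\<close> by \<open>m\<close> gives charge \<open>m\<close> and raises the weight by \<open>m (m + 1) / 2\<close>, and the diagrams of charge
  \<open>0\<close> have generating function \<open>1 / (q;q)\<^sub>\<infinity>\<close>: those with \<open>S \<subseteq> {0..<n}\<close> are moved by \<open>n\<close> shifts onto
  the \<open>n\<close>-element sets, counted by Euler's \<open>q\<close> to the power \<open>n (n + 1) / 2\<close> over \<open>(q;q)\<^sub>n\<close>. This is the Jacobi
  triple product in combinatorial form. It yields \<open>C\<Phi>\<^sub>4(q) (q;q)\<^sub>\<infinity>\<^sup>4\<close> as the sum of \<open>q\<close> to the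
  powers \<open>(m\<^sub>1\<^sup>2 + \<dots> + m\<^sub>4\<^sup>2) / 2\<close> over \<open>m\<^sub>1 + \<dots> + m\<^sub>4 = 0\<close>, the theta series of the root lattice
  \<open>A\<^sub>3\<close>. As \<open>A\<^sub>3 = D\<^sub>3\<close>, this is the sum of \<open>q\<close> to the powers \<open>(x\<^sup>2 + y\<^sup>2 + z\<^sup>2) / 2\<close> over \<open>x + y + z\<close>
  even, which splits by parities into the first formula. The second one follows from
  \<open>\<Theta>\<^sub>3(\<plusminus> q)\<^sup>2 = \<Theta>\<^sub>3(q\<^sup>2)\<^sup>2 \<plusminus> \<Theta>\<^sub>2(q\<^sup>2)\<^sup>2\<close> and the nonvanishing of \<open>\<Theta>\<^sub>3\<close>.
\<close>

section \<open>Infinite sums and products\<close>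

text \<open>Summability of complex families is absolute, so the norms of the products are summable
  on \<open>A \<times> B\<close>; the value is then found by summing over \<open>y\<close>
  first.\<close>

lemma has_sum_Times_mult:
  fixes f :: "'a \<Rightarrow> complex" and g :: "'b \<Rightarrow> complex"
  assumes f: "(f has_sum a) A" and g: "(g has_sum b) B"
  shows "((\<lambda>(x, y). f x * g y) has_sum a * b) (A \<times> B)"
proof -
  have "(\<lambda>x. norm (f x)) summable_on A" "(\<lambda>y. norm (g y)) summable_on B"
    using f g has_sum_imp_summable summable_on_iff_abs_summable_on_complex by blast+
  then have "(\<lambda>p. norm (case p of (x, y) \<Rightarrow> f x * g y)) summable_on A \<times> B"
    unfolding Infinite_Sum.abs_summable_on_Sigma_iff
    by (auto simp: norm_mult infsum_cmult_right' infsum_nonneg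
        intro!: summable_on_cmult_right summable_on_cmult_left)
  then have "(\<lambda>(x, y). f x * g y) summable_on A \<times> B"
    by (rule abs_summable_summable)
  then show ?thesis
    by (intro has_sum_SigmaI[where g = "\<lambda>x. f x * b"])
      (auto intro!: has_sum_cmult_right has_sum_cmult_left f g)
qed

text \<open>Induction on \<open>A\<close>: a function on \<open>insert x F\<close> is a function on
  \<open>F\<close> together with its value at \<open>x\<close>.\<close>

lemma has_sum_prod_PiE:
  fixes f :: "'a \<Rightarrow> 'b \<Rightarrow> complex"
  assumes "finite A" and "\<And>x. x \<in> A \<Longrightarrow> (f x has_sum s x) (B x)"
  shows "((\<lambda>g. \<Prod>x\<in>A. f x (g x)) has_sum (\<Prod>x\<in>A. s x)) (PiE A B)"
  using assms
proof (induction A rule: finite_induct)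
  case empty
  show ?case by (simp add: has_sum_finite_iff)
next
  case (insert x F)
  have bij: "bij_betw (\<lambda>(g, y). g(x := y)) (PiE F B \<times> B x) (PiE (insert x F) B)"
    unfolding bij_betw_def
    using inj_combinator'[OF insert.hyps(2), of B]
    by (auto simp: PiE_insert_eq image_iff)
  have "((\<lambda>(g, y). (\<Prod>z\<in>F. f z (g z)) * f x y) has_sum (\<Prod>z\<in>F. s z) * s x) (PiE F B \<times> B x)"
    by (intro has_sum_Times_mult insert) (auto intro: insert)
  also have "?this \<longleftrightarrow> ((\<lambda>p. \<Prod>z\<in>insert x F. f z (((\<lambda>(g, y). g(x := y)) p) z))
      has_sum (\<Prod>z\<in>insert x F. s z)) (PiE F B \<times> B x)"
  proof (intro has_sum_cong arg_cong2[where f = "\<lambda>a b. (a has_sum b) _"] ext)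
    show "(\<Prod>z\<in>F. s z) * s x = (\<Prod>z\<in>insert x F. s z)"
      using insert.hyps by (simp add: mult.commute)
  next
    fix p
    have "(\<Prod>z\<in>F. f z (if z = x then b else a z)) = (\<Prod>z\<in>F. f z (a z))" for a b
      using insert.hyps by (intro prod.cong) auto
    then show "(case p of (g, y) \<Rightarrow> (\<Prod>z\<in>F. f z (g z)) * f x y) =
          (\<Prod>z\<in>insert x F. f z (((\<lambda>(g, y). g(x := y)) p) z))"
      using insert.hyps by (cases p) (simp add: mult.commute fun_upd_def)
  qed
  finally show ?case
    by (subst (asm) has_sum_reindex_bij_betw[OF bij])
qed

text \<open>By absolute summability some finite \<open>F\<close> carries the sum of norms up to
  \<open>e / 2\<close>. Once \<open>B n\<close> contains \<open>F\<close>, the missing part is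
  bounded by the norms outside \<open>F\<close>.\<close>

lemma infsum_exhaustion_LIMSEQ:
  fixes f :: "'a \<Rightarrow> complex"
  assumes sum: "f summable_on A" and "incseq B" and A: "(\<Union>n. B n) = A"
  shows "(\<lambda>n. infsum f (B n)) \<longlonglongrightarrow> infsum f A"
proof (rule LIMSEQ_I)
  fix e :: real
  assume e: "e > 0"
  have abs: "(\<lambda>x. norm (f x)) summable_on A"
    using sum summable_on_iff_abs_summable_on_complex by blast
  obtain F where F: "finite F" "F \<subseteq> A"
    "dist (\<Sum>x\<in>F. norm (f x)) (infsum (\<lambda>x. norm (f x)) A) \<le> e / 2"
    using infsum_finite_approximation[OF abs, of "e / 2"] e by auto
  have "\<exists>n. F \<subseteq> B n"
    using F(1,2)
  proof (induction F rule: finite_induct)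
    case (insert x F)
    then obtain m n where "x \<in> B m" "F \<subseteq> B n"
      using A by blast
    then have "x \<in> B (max m n)" "F \<subseteq> B (max m n)"
      using incseqD[OF \<open>incseq B\<close>, of m "max m n"] incseqD[OF \<open>incseq B\<close>, of n "max m n"] by auto
    then show ?case by auto
  qed auto
  then obtain N where N: "F \<subseteq> B N" ..
  have "norm (infsum f (B n) - infsum f A) < e" if "n \<ge> N" for n
  proof -
    have BA: "B n \<subseteq> A" and FB: "F \<subseteq> B n"
      using A N incseqD[OF \<open>incseq B\<close> that] by auto
    have sub: "f summable_on C" "(\<lambda>x. norm (f x)) summable_on C" if "C \<subseteq> A" for C
      using summable_on_subset_banach sum abs that by blast+
    have "infsum f A = infsum f (B n) + infsum f (A - B n)"
      using BA by (subst infsum_Un_disjoint[symmetric]) (auto intro: sub simp: Un_absorb1)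
    then have "norm (infsum f (B n) - infsum f A) = norm (infsum f (A - B n))"
      by (simp add: norm_minus_commute)
    also have "\<dots> \<le> infsum (\<lambda>x. norm (f x)) (A - B n)"
      by (rule norm_infsum_bound) (auto intro: sub)
    also have "\<dots> \<le> infsum (\<lambda>x. norm (f x)) (A - F)"
      using FB by (intro infsum_mono2 sub) auto
    also have "\<dots> = infsum (\<lambda>x. norm (f x)) A - (\<Sum>x\<in>F. norm (f x))"
      using F infsum_Un_disjoint[of "\<lambda>x. norm (f x)" F "A - F"] sub[of "A - F"]
      by (auto simp: Un_absorb1)
    also have "\<dots> < e"
      using F(3) e unfolding dist_real_def by linarith
    finally show ?thesis .
  qed
  then show "\<exists>no. \<forall>n\<ge>no. norm (infsum f (B n) - infsum f A) < e" by blast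
qed

text \<open>Expanding a finite product of factors \<open>1 + f n\<close> gives a sum over subsets.
  Applied to norms, this bounds all finite partial sums by \<open>exp (\<Sum>n. norm (f n))\<close>;
  applied to \<open>f\<close> on \<open>{..N}\<close>, it identifies the limit.\<close>

lemma has_sum_finite_subsets_prod:
  fixes f :: "nat \<Rightarrow> complex"
  assumes f: "summable (\<lambda>n. norm (f n))"
  shows "((\<lambda>R. \<Prod>n\<in>R. f n) has_sum (\<Prod>n. 1 + f n)) {R. finite R}"
proof -
  have pow: "(\<Sum>R\<in>Pow B. \<Prod>n\<in>R. g n) = (\<Prod>n\<in>B. 1 + g n)" if "finite B"
    for B and g :: "nat \<Rightarrow> 'c :: comm_semiring_1"
    using prod_add[OF that, of g "\<lambda>_. 1"] by (simp add: add.commute)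
  have "(\<lambda>R. norm (\<Prod>n\<in>R. f n)) summable_on {R. finite R}"
    unfolding abs_summable_iff_bdd_above
  proof (rule bdd_aboveI2)
    fix \<R> :: "nat set set"
    assume \<R>: "\<R> \<in> {\<R>. \<R> \<subseteq> {R. finite R} \<and> finite \<R>}"
    then have fin: "finite (\<Union>\<R>)" by auto
    have "(\<Sum>R\<in>\<R>. norm (\<Prod>n\<in>R. f n)) \<le> (\<Sum>R\<in>Pow (\<Union>\<R>). norm (\<Prod>n\<in>R. f n))"
      using fin by (intro sum_mono2) auto
    also have "\<dots> = (\<Prod>n\<in>\<Union>\<R>. 1 + norm (f n))"
      using pow[OF fin, of "\<lambda>n. norm (f n)"] by (simp add: prod_norm)
    also have "\<dots> \<le> (\<Prod>n\<in>\<Union>\<R>. exp (norm (f n)))"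
      by (intro prod_mono) (auto simp: add_nonneg_nonneg)
    also have "\<dots> = exp (\<Sum>n\<in>\<Union>\<R>. norm (f n))"
      using fin by (simp add: exp_sum)
    also have "\<dots> \<le> exp (\<Sum>n. norm (f n))"
      using fin f by (simp add: sum_le_suminf)
    finally show "(\<Sum>R\<in>\<R>. norm (\<Prod>n\<in>R. f n)) \<le> exp (\<Sum>n. norm (f n))" .
  qed
  then have sum: "(\<lambda>R. \<Prod>n\<in>R. f n) summable_on {R. finite R}"
    by (rule abs_summable_summable)
  have "(\<lambda>N. infsum (\<lambda>R. \<Prod>n\<in>R. f n) (Pow {..N})) \<longlonglongrightarrow>
      infsum (\<lambda>R. \<Prod>n\<in>R. f n) {R. finite R}"
    using sum
  proof (rule infsum_exhaustion_LIMSEQ)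
    show "incseq (\<lambda>N. Pow {..N::nat})"
      by (force simp: incseq_def)
    show "(\<Union>N. Pow {..N::nat}) = {R. finite R}"
      by (auto simp: finite_nat_set_iff_bounded_le finite_subset)
  qed
  then have 1: "(\<lambda>N. \<Prod>n\<le>N. 1 + f n) \<longlonglongrightarrow> infsum (\<lambda>R. \<Prod>n\<in>R. f n) {R. finite R}"
    by (simp add: pow)
  have "convergent_prod (\<lambda>n. 1 + f n)"
    using f by (intro abs_convergent_prod_imp_convergent_prod summable_imp_abs_convergent_prod) simp
  then have "(\<lambda>N. \<Prod>n\<le>N. 1 + f n) \<longlonglongrightarrow> (\<Prod>n. 1 + f n)"
    by (rule convergent_prod_LIMSEQ)
  with 1 have "infsum (\<lambda>R. \<Prod>n\<in>R. f n) {R. finite R} = (\<Prod>n. 1 + f n)"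
    using LIMSEQ_unique by blast
  with sum show ?thesis
    by (simp add: has_sum_iff)
qed

lemma prodinf_one_plus_nonzero:
  fixes f :: "nat \<Rightarrow> complex"
  assumes "summable (\<lambda>n. norm (f n))" "\<And>n. norm (f n) < 1"
  shows "(\<Prod>n. 1 + f n) \<noteq> 0"
proof (rule prodinf_nonzero)
  show "convergent_prod (\<lambda>n. 1 + f n)"
    using assms(1)
    by (intro abs_convergent_prod_imp_convergent_prod summable_imp_abs_convergent_prod) simp
  show "1 + f n \<noteq> 0" for n
    using assms(2)[of n] by (metis add_eq_0_iff norm_minus_cancel norm_one order_less_irrefl)
qed

section \<open>Maya diagrams\<close>

type_synonym maya = "nat set \<times> nat set"

text \<open>
  The pair \<open>(R, S)\<close> encodes the Maya diagram in which the positions \<open>l \<ge> 0\<close> with \<open>l \<in> R\<close> and the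
  positions \<open>- 1 - l\<close> with \<open>l \<notin> S\<close> are occupied; \<open>shift\<close> moves all occupied positions up by one.
\<close>

definition charge :: "maya \<Rightarrow> int" where
  "charge p = int (card (fst p)) - int (card (snd p))"

text \<open>Elements of the first component weigh \<open>l + 1\<close> because the size of a
  Frobenius symbol also counts its columns, one for each entry of the top row.\<close>

definition energy :: "maya \<Rightarrow> nat" where
  "energy p = (\<Sum>l\<in>fst p. Suc l) + (\<Sum>l\<in>snd p. l)"

definition mayas :: "maya set" where
  "mayas = {R. finite R} \<times> {S. finite S}"

definition sector :: "int \<Rightarrow> maya set" where
  "sector m = {p \<in> mayas. charge p = m}"

definition shift :: "maya \<Rightarrow> maya" where
  "shift = (\<lambda>(R, S). (if 0 \<in> S then Suc ` R else insert 0 (Suc ` R), {l. Suc l \<in> S}))"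

text \<open>Swapping \<open>R\<close> and \<open>S\<close> reflects the positions and exchanges
  occupied with empty ones, so conjugation by the swap turns a move up into a move down.\<close>

definition unshift :: "maya \<Rightarrow> maya" where
  "unshift = prod.swap \<circ> shift \<circ> prod.swap"

lemma finite_Suc_vimage: "finite S \<Longrightarrow> finite {l. Suc l \<in> S}"
  using finite_vimageI[of S Suc] by (simp add: vimage_def)

lemma sum_split_Suc:
  fixes f :: "nat \<Rightarrow> 'a :: comm_monoid_add"
  assumes "finite S"
  shows "(\<Sum>l\<in>S. f l) = (if 0 \<in> S then f 0 else 0) + (\<Sum>l | Suc l \<in> S. f (Suc l))"
proof -
  have "S - {0} = Suc ` {l. Suc l \<in> S}"
    by (auto simp: image_iff) (metis not0_implies_Suc)
  then have "(\<Sum>l\<in>S - {0}. f l) = (\<Sum>l | Suc l \<in> S. f (Suc l))"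
    by (simp add: sum.reindex)
  then show ?thesis
    using assms by (cases "0 \<in> S") (simp_all add: sum.remove)
qed

lemma card_split_Suc:
  assumes "finite S"
  shows "card S = (if 0 \<in> S then 1 else 0) + card {l. Suc l \<in> S}"
  using sum_split_Suc[OF assms, of "\<lambda>_. 1 :: nat"] by simp

lemma sum_Suc_image: "(\<Sum>l\<in>Suc ` R. Suc l) = (\<Sum>l\<in>R. Suc l) + card R"
  by (subst sum.reindex) (simp_all add: sum_Suc)

lemma unshift_shift: "unshift (shift p) = p"
  by (cases p) (auto simp: unshift_def shift_def image_iff, (metis not0_implies_Suc)+)

lemma shift_unshift: "shift (unshift p) = p"
  using unshift_shift[of "prod.swap p"] unfolding unshift_def o_def
  by (metis swap_swap)

text \<open>Each element of \<open>R\<close> gains one unit of energy and each nonzero element of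
  \<open>S\<close> loses one. In addition either \<open>0\<close> leaves \<open>S\<close> at no cost
  or \<open>0\<close> enters \<open>R\<close> with weight 1; both cases give the same total.\<close>

lemma shift_props:
  assumes "p \<in> mayas"
  shows "shift p \<in> mayas" "charge (shift p) = charge p + 1"
    "int (energy (shift p)) = int (energy p) + charge p + 1"
proof -
  obtain R S where p: "p = (R, S)" "finite R" "finite S"
    using assms by (cases p) (auto simp: mayas_def)
  show "shift p \<in> mayas"
    using p finite_Suc_vimage by (auto simp: shift_def mayas_def)
  have R: "card (Suc ` R) = card R"
    by (rule card_image) simp
  show "charge (shift p) = charge p + 1"
    using p R card_split_Suc[of S] by (auto simp: charge_def shift_def)
  have S': "(\<Sum>l\<in>S. l) = (\<Sum>l | Suc l \<in> S. l) + card {l. Suc l \<in> S}"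
    using sum_split_Suc[of S "\<lambda>l. l"] p by (simp add: sum_Suc)
  show "int (energy (shift p)) = int (energy p) + charge p + 1"
    using p sum_Suc_image[of R] S' card_split_Suc[of S]
    by (simp add: charge_def energy_def shift_def del: of_nat_sum)
qed

lemma unshift_props:
  assumes "p \<in> mayas"
  shows "unshift p \<in> mayas" "charge (unshift p) = charge p - 1"
    "int (energy (unshift p)) = int (energy p) - charge p"
proof -
  have "prod.swap p \<in> mayas"
    using assms by (auto simp: mayas_def)
  then show m: "unshift p \<in> mayas"
    using shift_props(1)[of "prod.swap p"] by (auto simp: unshift_def mayas_def)
  show "charge (unshift p) = charge p - 1" "int (energy (unshift p)) = int (energy p) - charge p"
    using shift_props(2,3)[OF m] by (simp_all add: shift_unshift)
qed

lemma charge_funpow_shift: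
  "p \<in> mayas \<Longrightarrow> (shift ^^ n) p \<in> mayas \<and> charge ((shift ^^ n) p) = charge p + int n"
  by (induction n) (auto simp: shift_props)

lemma charge_funpow_unshift:
  "p \<in> mayas \<Longrightarrow> (unshift ^^ n) p \<in> mayas \<and> charge ((unshift ^^ n) p) = charge p - int n"
  by (induction n) (auto simp: unshift_props)

text \<open>The successive charges are 0, 1, 2, ..., so the shifts cost 1, 2, ..., \<open>n\<close>.
  Doubling avoids a division.\<close>

lemma energy_funpow_shift:
  assumes "p \<in> sector 0"
  shows "2 * int (energy ((shift ^^ n) p)) = 2 * int (energy p) + int n * (int n + 1)"
proof (induction n)
  case (Suc n)
  have "(shift ^^ n) p \<in> mayas" "charge ((shift ^^ n) p) = int n"
    using assms charge_funpow_shift by (auto simp: sector_def)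
  with Suc show ?case
    using shift_props(3)[of "(shift ^^ n) p"] by (simp add: algebra_simps)
qed auto

text \<open>Downward the charges are 0, -1, -2, ..., and the moves cost 0, 1, ...,
  \<open>n - 1\<close>.\<close>

lemma energy_funpow_unshift:
  assumes "p \<in> sector 0"
  shows "2 * int (energy ((unshift ^^ n) p)) = 2 * int (energy p) + int n * (int n - 1)"
proof (induction n)
  case (Suc n)
  have "(unshift ^^ n) p \<in> mayas" "charge ((unshift ^^ n) p) = - int n"
    using assms charge_funpow_unshift by (auto simp: sector_def)
  with Suc show ?case
    using unshift_props(3)[of "(unshift ^^ n) p"] by (simp add: algebra_simps)
qed auto

lemma funpow_inverse:
  fixes f g :: "'a \<Rightarrow> 'a"
  assumes "\<And>x. f (g x) = x"
  shows "(f ^^ n) ((g ^^ n) x) = x"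
  by (induction n arbitrary: x) (use assms in \<open>simp_all add: funpow_swap1[of f]\<close>)

section \<open>Translation of diagrams by an arbitrary charge\<close>

definition translate :: "int \<Rightarrow> maya \<Rightarrow> maya" where
  "translate m = (if m \<ge> 0 then shift ^^ nat m else unshift ^^ nat (- m))"

lemma translate_inverse: "translate (- m) (translate m p) = p"
  by (auto simp: translate_def funpow_inverse shift_unshift unshift_shift)

lemma translate_sector: "p \<in> sector n \<Longrightarrow> translate m p \<in> sector (n + m)"
  by (auto simp: translate_def sector_def charge_funpow_shift charge_funpow_unshift)

definition triangular :: "int \<Rightarrow> nat" where
  "triangular m = nat (m * (m + 1) div 2)"

text \<open>For every integer \<open>m\<close> the product \<open>m * (m + 1)\<close> is nonnegative
  and even, so neither \<open>nat\<close> nor \<open>div\<close> loses anything.\<close>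

lemma two_triangular: "2 * int (triangular m) = m * (m + 1)"
proof -
  have "0 \<le> m * (m + 1)"
    by (cases "m \<ge> 0") (auto simp: mult_nonpos_nonpos)
  moreover have "even (m * (m + 1))" by simp
  ultimately show ?thesis
    by (simp add: triangular_def pos_imp_zdiv_nonneg_iff)
qed

text \<open>One formula serves both directions: for \<open>m = - n\<close> the cost n (n - 1) / 2 of
  the downward moves is again \<open>triangular m\<close>.\<close>

lemma energy_translate:
  assumes "p \<in> sector 0"
  shows "energy (translate m p) = energy p + triangular m"
proof -
  have "2 * int (energy (translate m p)) = 2 * int (energy p) + m * (m + 1)"
    using energy_funpow_shift[OF assms, of "nat m"] energy_funpow_unshift[OF assms, of "nat (- m)"]
    by (auto simp: translate_def algebra_simps)
  then show ?thesis
    using two_triangular[of m] by linarith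
qed

text \<open>The integer \<open>m\<close> is recovered as the charge, and translating back by the
  charge recovers the neutral diagram.\<close>

lemma bij_betw_translate: "bij_betw (\<lambda>(m, p). translate m p) (UNIV \<times> sector 0) mayas"
proof (rule bij_betw_byWitness[where f' = "\<lambda>p. (charge p, translate (- charge p) p)"])
  show "\<forall>a\<in>UNIV \<times> sector 0. (charge (case a of (m, p) \<Rightarrow> translate m p),
      translate (- charge (case a of (m, p) \<Rightarrow> translate m p)) (case a of (m, p) \<Rightarrow> translate m p)) = a"
    using translate_sector[of _ 0] by (auto simp: translate_inverse sector_def)
  show "\<forall>p\<in>mayas. (case (charge p, translate (- charge p) p) of (m, p) \<Rightarrow> translate m p) = p"
    using translate_inverse[of "- _"] by simp
  show "(\<lambda>(m, p). translate m p) ` (UNIV \<times> sector 0) \<subseteq> mayas"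
    using translate_sector[of _ 0] by (auto simp: sector_def)
  show "(\<lambda>p. (charge p, translate (- charge p) p)) ` mayas \<subseteq> UNIV \<times> sector 0"
    using translate_sector[of _ "charge _" "- charge _"] by (auto simp: sector_def)
qed

section \<open>Generating function of the neutral diagrams\<close>

lemma summable_norm_power_linear:
  fixes q :: complex
  assumes "norm q < 1" and "a > 0"
  shows "summable (\<lambda>n. norm (q ^ (a * n + b)))"
proof -
  have "norm q ^ a < 1"
    using assms by (simp add: power_less_one_iff)
  then have "summable (\<lambda>n. (norm q ^ a) ^ n * norm q ^ b)"
    by (intro summable_mult2 summable_geometric) simp
  then show ?thesis
    by (simp add: norm_power norm_mult power_add power_mult)
qed

text \<open>The weights needed are \<open>l + 1\<close> and \<open>l\<close> for the two components
  of a diagram, and later the odd numbers \<open>2 * l + 1\<close>.\<close>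

lemma has_sum_finite_subsets_power:
  fixes q :: complex
  assumes "norm q < 1" and "a > 0"
  shows "((\<lambda>R. q ^ (\<Sum>l\<in>R. a * l + b)) has_sum (\<Prod>n. 1 + q ^ (a * n + b))) {R. finite R}"
  using has_sum_finite_subsets_prod[OF summable_norm_power_linear[OF assms]]
  by (simp add: power_sum)

lemma summable_on_mayas:
  fixes q :: complex
  assumes "norm q < 1"
  shows "(\<lambda>p. q ^ energy p) summable_on mayas"
  using has_sum_Times_mult[OF has_sum_finite_subsets_power[OF assms, of 1 1]
      has_sum_finite_subsets_power[OF assms, of 1 0]]
  by (auto simp: mayas_def energy_def power_add case_prod_unfold summable_on_def)

section \<open>Sets of prescribed size and Euler's identity\<close>

definition card_sets :: "nat \<Rightarrow> nat set set" where
  "card_sets n = {R. finite R \<and> card R = n}"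

lemma bij_betw_Suc_image:
  "bij_betw ((`) Suc) (card_sets n) {R \<in> card_sets n. 0 \<notin> R}"
proof (rule bij_betw_byWitness[where f' = "\<lambda>R. {l. Suc l \<in> R}"])
  show "\<forall>R\<in>{R \<in> card_sets n. 0 \<notin> R}. Suc ` {l. Suc l \<in> R} = R"
    by (auto simp: image_iff) (metis not0_implies_Suc)
  have "{l. Suc l \<in> R} \<in> card_sets n" if "R \<in> {R \<in> card_sets n. 0 \<notin> R}" for R
    using that card_split_Suc[of R] by (simp add: card_sets_def finite_Suc_vimage)
  then show "(\<lambda>R. {l. Suc l \<in> R}) ` {R \<in> card_sets n. 0 \<notin> R} \<subseteq> card_sets n"
    by auto
qed (auto simp: card_sets_def card_image)

lemma bij_betw_insert_Suc_image:
  "bij_betw (\<lambda>R. insert 0 (Suc ` R)) (card_sets n) {R \<in> card_sets (Suc n). 0 \<in> R}"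
proof (rule bij_betw_byWitness[where f' = "\<lambda>R. {l. Suc l \<in> R}"])
  show "\<forall>R\<in>{R \<in> card_sets (Suc n). 0 \<in> R}. insert 0 (Suc ` {l. Suc l \<in> R}) = R"
    by (auto simp: image_iff) (metis not0_implies_Suc)
  have "{l. Suc l \<in> R} \<in> card_sets n" if "R \<in> {R \<in> card_sets (Suc n). 0 \<in> R}" for R
    using that card_split_Suc[of R] by (simp add: card_sets_def finite_Suc_vimage)
  then show "(\<lambda>R. {l. Suc l \<in> R}) ` {R \<in> card_sets (Suc n). 0 \<in> R} \<subseteq> card_sets n"
    by auto
qed (auto simp: card_sets_def card_image)

text \<open>Let F(n) be the sum over \<open>card_sets n\<close>. Sets of size n + 1 are split by
  whether they contain \<open>0\<close>, and removing \<open>0\<close> and lowering the rest by one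
  gives F(n + 1) = q^(n + 1) F(n + 1) + q^(n + 1) F(n).\<close>

lemma infsum_card_sets:
  fixes q :: complex
  assumes q: "norm q < 1"
  shows "infsum (\<lambda>R. q ^ (\<Sum>l\<in>R. Suc l)) (card_sets n) * (\<Prod>j<n. 1 - q * q ^ j) = q ^ triangular (int n)"
proof (induction n)
  case 0
  have "card_sets 0 = {{}}"
    by (auto simp: card_sets_def)
  then show ?case by (simp add: triangular_def)
next
  case (Suc n)
  define f where "f R = q ^ (\<Sum>l\<in>R. Suc l)" for R
  have sum: "f summable_on A" if "A \<subseteq> {R. finite R}" for A
    using has_sum_imp_summable[OF has_sum_finite_subsets_power[OF q, of 1 1]] that
    by (intro summable_on_subset_banach[OF _ that]) (simp add: f_def[abs_def])
  have f_Suc: "f (Suc ` R) = q ^ m * f R" "f (insert 0 (Suc ` R)) = q ^ Suc m * f R"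
    if "R \<in> card_sets m" for R m
    using that by (simp_all add: f_def card_sets_def sum_Suc_image power_add)
  have *: "infsum f {R \<in> card_sets (Suc n). 0 \<notin> R} = q ^ Suc n * infsum f (card_sets (Suc n))"
    "infsum f {R \<in> card_sets (Suc n). 0 \<in> R} = q ^ Suc n * infsum f (card_sets n)"
    using infsum_reindex_bij_betw[OF bij_betw_Suc_image, of f "Suc n"]
      infsum_reindex_bij_betw[OF bij_betw_insert_Suc_image, of f n]
    by (simp_all add: f_Suc infsum_cmult_right' cong: infsum_cong)
  have "infsum f (card_sets (Suc n)) =
      infsum f ({R \<in> card_sets (Suc n). 0 \<notin> R} \<union> {R \<in> card_sets (Suc n). 0 \<in> R})"
    by (rule arg_cong[where f = "infsum f"]) blast
  also have "\<dots> = q ^ Suc n * infsum f (card_sets (Suc n)) + q ^ Suc n * infsum f (card_sets n)"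
    unfolding *[symmetric] by (intro infsum_Un_disjoint sum) (auto simp: card_sets_def)
  finally have "infsum f (card_sets (Suc n)) =
      q ^ Suc n * infsum f (card_sets (Suc n)) + q ^ Suc n * infsum f (card_sets n)" .
  then have "infsum f (card_sets (Suc n)) * (1 - q * q ^ n) = q ^ Suc n * infsum f (card_sets n)"
    by (simp add: algebra_simps)
  then have "infsum f (card_sets (Suc n)) * (\<Prod>j<Suc n. 1 - q * q ^ j) =
      q ^ Suc n * (infsum f (card_sets n) * (\<Prod>j<n. 1 - q * q ^ j))"
    by simp
  also have "\<dots> = q ^ (Suc n + triangular (int n))"
    using Suc by (simp add: f_def[abs_def] power_add)
  also have "Suc n + triangular (int n) = triangular (int (Suc n))"
    using two_triangular[of "int n"] two_triangular[of "int (Suc n)"] by (simp add: algebra_simps)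
  finally show ?case by (simp only: f_def[abs_def])
qed

text \<open>A shift lowers the positive elements of \<open>S\<close> by one and drops
  \<open>0\<close>, so the bound on \<open>S\<close> decreases by one. After \<open>n\<close> shifts
  a bound \<open>n\<close> has become 0, which forces \<open>S\<close> to be empty.\<close>

lemma bij_betw_shift:
  "bij_betw shift {p \<in> sector m. snd p \<subseteq> {..<Suc N}} {p \<in> sector (m + 1). snd p \<subseteq> {..<N}}"
proof (rule bij_betw_byWitness[where f' = unshift])
  show "shift ` {p \<in> sector m. snd p \<subseteq> {..<Suc N}} \<subseteq> {p \<in> sector (m + 1). snd p \<subseteq> {..<N}}"
    using shift_props by (auto simp: sector_def) (auto simp: shift_def)
  show "unshift ` {p \<in> sector (m + 1). snd p \<subseteq> {..<N}} \<subseteq> {p \<in> sector m. snd p \<subseteq> {..<Suc N}}"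
    using unshift_props by (auto simp: sector_def) (auto simp: unshift_def shift_def split: if_splits)
qed (auto simp: unshift_shift shift_unshift)

lemma bij_betw_funpow_shift:
  "bij_betw (shift ^^ n) {p \<in> sector 0. snd p \<subseteq> {..<n + N}} {p \<in> sector (int n). snd p \<subseteq> {..<N}}"
proof (induction n arbitrary: N)
  case (Suc n)
  show ?case
    using bij_betw_trans[OF Suc.IH[of "Suc N"] bij_betw_shift[of "int n" N]]
    by (simp add: o_def add.commute)
qed auto

lemma infsum_sector_bounded:
  fixes q :: complex
  assumes q: "norm q < 1" "q \<noteq> 0"
  shows "infsum (\<lambda>p. q ^ energy p) {p \<in> sector 0. snd p \<subseteq> {..<n}} * (\<Prod>j<n. 1 - q * q ^ j) = 1"
proof -
  have "bij_betw (\<lambda>R. (R, {})) (card_sets n) {p \<in> sector (int n). snd p \<subseteq> {..<0}}"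
    by (rule bij_betw_byWitness[where f' = fst])
      (auto simp: card_sets_def sector_def mayas_def charge_def)
  then have "infsum (\<lambda>R. q ^ (\<Sum>l\<in>R. Suc l)) (card_sets n) =
      infsum (\<lambda>p. q ^ energy p) {p \<in> sector (int n). snd p \<subseteq> {..<0}}"
    by (subst infsum_reindex_bij_betw[symmetric]) (auto simp: energy_def)
  also have "\<dots> = infsum (\<lambda>p. q ^ energy ((shift ^^ n) p)) {p \<in> sector 0. snd p \<subseteq> {..<n}}"
    using bij_betw_funpow_shift[of n 0] by (subst infsum_reindex_bij_betw) auto
  also have "\<dots> = infsum (\<lambda>p. q ^ triangular (int n) * q ^ energy p) {p \<in> sector 0. snd p \<subseteq> {..<n}}"
    using energy_translate[of _ "int n"]
    by (intro infsum_cong) (auto simp: translate_def power_add)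
  \<comment> \<open>Both this sum and Euler's identity carry the factor
    \<open>q ^ triangular (int n)\<close>, which cancels because
    \<open>q \<noteq> 0\<close>.\<close>
  finally show ?thesis
    using infsum_card_sets[OF q(1), of n] q(2) by (simp add: infsum_cmult_right')
qed

lemma qpoch_inf_nonzero:
  assumes "norm q < 1"
  shows "qpoch_inf q q \<noteq> 0"
proof -
  have "norm q * norm q ^ n < 1" for n
    using power_less_one_iff[of "norm q" "Suc n"] assms by simp
  then show ?thesis
    using prodinf_one_plus_nonzero[of "\<lambda>n. - (q * q ^ n)"]
      summable_norm_power_linear[OF assms, of 1 1]
    by (simp add: qpoch_inf_def norm_mult norm_power)
qed

text \<open>The neutral diagrams are exhausted by those with \<open>S\<close> below
  \<open>n\<close>. The sum over these times the \<open>n\<close>-th partial product is constantly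
  1, and this passes to the limit.\<close>

lemma has_sum_sector_0:
  assumes q: "norm q < 1"
  shows "((\<lambda>p. q ^ energy p) has_sum 1 / qpoch_inf q q) (sector 0)"
proof -
  have sum: "(\<lambda>p. q ^ energy p) summable_on sector 0"
    using summable_on_mayas[OF q] by (rule summable_on_subset_banach) (auto simp: sector_def)
  have "infsum (\<lambda>p. q ^ energy p) (sector 0) * qpoch_inf q q = 1"
  proof (cases "q = 0")
    case True
    \<comment> \<open>Every other neutral diagram has a nonempty first component, hence positive
      energy; the empty diagram contributes \<open>0 ^ 0 = 1\<close>.\<close>
    have "infsum (\<lambda>p. q ^ energy p) (sector 0) = infsum (\<lambda>p. q ^ energy p) {({}, {})}"
    proof (rule infsum_cong_neutral)
      fix p :: maya
      assume "p \<in> sector 0 - {({}, {})}"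
      then have "fst p \<noteq> {}" "finite (fst p)"
        by (auto simp: sector_def mayas_def charge_def)
      then have "energy p \<noteq> 0" by (auto simp: energy_def)
      then show "q ^ energy p = 0" using True by simp
    qed (auto simp: sector_def mayas_def charge_def)
    with True show ?thesis by (simp add: qpoch_inf_def energy_def)
  next
    case False
    define P where "P n = (\<Prod>j<n. 1 - q * q ^ j)" for n
    have "(\<lambda>n. infsum (\<lambda>p. q ^ energy p) {p \<in> sector 0. snd p \<subseteq> {..<n}})
        \<longlonglongrightarrow> infsum (\<lambda>p. q ^ energy p) (sector 0)"
      using sum
    proof (rule infsum_exhaustion_LIMSEQ)
      show "incseq (\<lambda>n. {p \<in> sector 0. snd p \<subseteq> {..<n}})"
        by (force simp: incseq_def)
      show "(\<Union>n. {p \<in> sector 0. snd p \<subseteq> {..<n}}) = sector 0"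
      proof -
        have "\<exists>n. snd p \<subseteq> {..<n}" if "p \<in> sector 0" for p
          using that finite_nat_iff_bounded[of "snd p"] by (auto simp: sector_def mayas_def)
        then show ?thesis by auto
      qed
    qed
    moreover have "P \<longlonglongrightarrow> qpoch_inf q q"
    proof -
      have "convergent_prod (\<lambda>n. 1 - q * q ^ n)"
        using summable_norm_power_linear[OF q, of 1 1]
        by (intro abs_convergent_prod_imp_convergent_prod summable_imp_abs_convergent_prod) simp
      \<comment> \<open>The limit of partial products runs over \<open>{..n}\<close>, which is
        \<open>{..<Suc n}\<close>; hence the index \<open>Suc n\<close>.\<close>
      then have "(\<lambda>n. P (Suc n)) \<longlonglongrightarrow> qpoch_inf q q"
        unfolding P_def qpoch_inf_def lessThan_Suc_atMost by (rule convergent_prod_LIMSEQ)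
      then show ?thesis by (simp add: filterlim_sequentially_Suc)
    qed
    ultimately have "(\<lambda>n. infsum (\<lambda>p. q ^ energy p) {p \<in> sector 0. snd p \<subseteq> {..<n}} * P n)
        \<longlonglongrightarrow> infsum (\<lambda>p. q ^ energy p) (sector 0) * qpoch_inf q q"
      by (rule tendsto_mult)
    moreover have "infsum (\<lambda>p. q ^ energy p) {p \<in> sector 0. snd p \<subseteq> {..<n}} * P n = 1" for n
      unfolding P_def by (rule infsum_sector_bounded[OF q False])
    ultimately show ?thesis by (simp add: LIMSEQ_const_iff)
  qed
  then show ?thesis
    using sum qpoch_inf_nonzero[OF q] by (simp add: has_sum_iff field_simps)
qed

section \<open>Colour decomposition of Frobenius symbols\<close>

text \<open>The order is reversed so that the strictly decreasing rows are exactly the strictly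
  sorted lists of a linear order; such a list is determined by its set.\<close>

lemma linorder_colored: "class.linorder (\<lambda>x y. x = y \<or> y \<prec>\<^sub>c x) (\<lambda>x y. y \<prec>\<^sub>c x)"
  by unfold_locales (auto simp: colored_less_def prod_eq_iff)

lemma frobenius_row_inject:
  assumes "frobenius_row k r" "frobenius_row k r'" "set r = set r'"
  shows "r = r'"
proof -
  interpret linorder "\<lambda>x y. x = y \<or> y \<prec>\<^sub>c x" "\<lambda>x y. y \<prec>\<^sub>c x"
    by (rule linorder_colored)
  show ?thesis
    by (rule strict_sorted_equal) (use assms in \<open>auto simp only: frobenius_row_def\<close>)
qed

lemma distinct_frobenius_row:
  assumes "frobenius_row k r"
  shows "distinct r"
proof -
  interpret linorder "\<lambda>x y. x = y \<or> y \<prec>\<^sub>c x" "\<lambda>x y. y \<prec>\<^sub>c x"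
    by (rule linorder_colored)
  show ?thesis
    using strict_sorted_iff[of r] assms by (simp add: frobenius_row_def)
qed

lemma frobenius_row_exists:
  assumes "finite A" "snd ` A \<subseteq> {1..k}"
  obtains r where "frobenius_row k r" "set r = A"
proof -
  interpret linorder "\<lambda>x y. x = y \<or> y \<prec>\<^sub>c x" "\<lambda>x y. y \<prec>\<^sub>c x"
    by (rule linorder_colored)
  obtain r where "sorted_wrt (\<lambda>x y. y \<prec>\<^sub>c x) r" "set r = A"
    using ex1_sorted_list_for_set_if_finite[OF assms(1)] by blast
  then show ?thesis
    using assms(2) by (intro that[of r]) (auto simp: frobenius_row_def)
qed

lemma finite_color_class: "finite {l. (l, c) \<in> set r}"
  by (rule finite_subset[of _ "fst ` set r"]) force+

text \<open>The entries are distinct, so the sum may be taken over the set of entries and grouped by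
  colour. The general \<open>f\<close> covers the length, the values and the values plus
  one.\<close>

lemma sum_list_frobenius_row:
  fixes f :: "nat \<Rightarrow> nat"
  assumes "frobenius_row k r"
  shows "sum_list (map (\<lambda>x. f (fst x)) r) = (\<Sum>c\<in>{1..k}. \<Sum>l | (l, c) \<in> set r. f l)"
proof -
  have "sum_list (map (\<lambda>x. f (fst x)) r) = (\<Sum>x\<in>set r. f (fst x))"
    by (intro sum_list_distinct_conv_sum_set distinct_frobenius_row[OF assms])
  also have "\<dots> = (\<Sum>p\<in>(SIGMA c:{1..k}. {l. (l, c) \<in> set r}). f (snd p))"
    by (rule sum.reindex_bij_witness[of _ prod.swap prod.swap])
      (use assms in \<open>auto simp: frobenius_row_def\<close>)
  also have "\<dots> = (\<Sum>c\<in>{1..k}. \<Sum>l | (l, c) \<in> set r. f l)"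
    by (subst sum.Sigma) (auto simp: case_prod_unfold finite_color_class)
  finally show ?thesis .
qed

lemma length_frobenius_row:
  "frobenius_row k r \<Longrightarrow> length r = (\<Sum>c\<in>{1..k}. card {l. (l, c) \<in> set r})"
  using sum_list_frobenius_row[of k r "\<lambda>_. 1"] by (simp add: sum_list_triv)

text \<open>\<open>PiE\<close> fixes the values at indices outside \<open>{1..k}\<close>, so that
  each symbol corresponds to exactly one family.\<close>

definition neutral_mayas :: "nat \<Rightarrow> (nat \<Rightarrow> maya) set" where
  "neutral_mayas k = {g \<in> PiE {1..k} (\<lambda>_. mayas). (\<Sum>c\<in>{1..k}. charge (g c)) = 0}"

definition neutral_charges :: "nat \<Rightarrow> (nat \<Rightarrow> int) set" where
  "neutral_charges k = {m \<in> PiE {1..k} (\<lambda>_. UNIV). (\<Sum>c\<in>{1..k}. m c) = 0}"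

definition color_split :: "nat \<Rightarrow> colored list \<times> colored list \<Rightarrow> nat \<Rightarrow> maya" where
  "color_split k F = (\<lambda>c\<in>{1..k}. ({l. (l, c) \<in> set (fst F)}, {l. (l, c) \<in> set (snd F)}))"

lemma set_row_eqI:
  assumes "frobenius_row k r" "frobenius_row k r'"
    and "\<And>c. c \<in> {1..k} \<Longrightarrow> {l. (l, c) \<in> set r} = {l. (l, c) \<in> set r'}"
  shows "r = r'"
proof (rule frobenius_row_inject[OF assms(1,2)])
  have "(l, c) \<in> set r \<longleftrightarrow> (l, c) \<in> set r'" for l c
  proof (cases "c \<in> {1..k}")
    case True
    then show ?thesis using assms(3)[OF True] by blast
  next
    case False
    then show ?thesis using assms(1,2) unfolding frobenius_row_def by force
  qed
  then show "set r = set r'" by auto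
qed

lemma frobenius_row_of_classes:
  fixes g :: "nat \<Rightarrow> nat set"
  assumes "\<And>c. c \<in> {1..k} \<Longrightarrow> finite (g c)"
  obtains r where "frobenius_row k r" "\<And>c. c \<in> {1..k} \<Longrightarrow> {l. (l, c) \<in> set r} = g c"
proof -
  define A where "A = prod.swap ` (SIGMA c:{1..k}. g c)"
  have "finite A" "snd ` A \<subseteq> {1..k}"
    using assms by (auto simp: A_def intro!: finite_imageI finite_SigmaI)
  then obtain r where "frobenius_row k r" "set r = A"
    by (rule frobenius_row_exists)
  then show ?thesis
    by (intro that[of r]) (force simp: A_def)+
qed

lemma charge_color_split:
  assumes "frobenius_row k r" "frobenius_row k s"
  shows "(\<Sum>c\<in>{1..k}. charge (color_split k (r, s) c)) = int (length r) - int (length s)"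
  unfolding length_frobenius_row[OF assms(1)] length_frobenius_row[OF assms(2)]
  by (simp add: color_split_def charge_def sum_subtractf)

text \<open>A row is determined by its colour classes, and any finite classes can be assembled into
  a row. The two rows have equal length exactly when the total charge vanishes.\<close>

lemma bij_betw_color_split:
  "bij_betw (color_split k) (frobenius_symbols k) (neutral_mayas k)"
  unfolding bij_betw_def
proof (intro conjI inj_onI subset_antisym subsetI)
  fix F F'
  assume F: "F \<in> frobenius_symbols k" "F' \<in> frobenius_symbols k"
    and eq: "color_split k F = color_split k F'"
  have "{l. (l, c) \<in> set (fst F)} = {l. (l, c) \<in> set (fst F')}"
    "{l. (l, c) \<in> set (snd F)} = {l. (l, c) \<in> set (snd F')}" if "c \<in> {1..k}" for c
    using fun_cong[OF eq, of c] that by (auto simp: color_split_def)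
  then show "F = F'"
    using F set_row_eqI[of k "fst F" "fst F'"] set_row_eqI[of k "snd F" "snd F'"]
    by (auto simp: frobenius_symbols_def prod_eq_iff)
next
  fix g
  assume "g \<in> color_split k ` frobenius_symbols k"
  then obtain r s where "frobenius_row k r" "frobenius_row k s" "length r = length s"
    "g = color_split k (r, s)"
    by (auto simp: frobenius_symbols_def)
  then show "g \<in> neutral_mayas k"
    using charge_color_split[of k r s]
    by (auto simp: neutral_mayas_def color_split_def mayas_def finite_color_class)
next
  fix g
  assume g: "g \<in> neutral_mayas k"
  then have fin: "finite (fst (g c))" "finite (snd (g c))" if "c \<in> {1..k}" for c
    using that by (force simp: neutral_mayas_def mayas_def PiE_iff)+
  obtain r where r: "frobenius_row k r" "\<And>c. c \<in> {1..k} \<Longrightarrow> {l. (l, c) \<in> set r} = fst (g c)"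
    using frobenius_row_of_classes[of k "\<lambda>c. fst (g c)"] fin by blast
  obtain s where s: "frobenius_row k s" "\<And>c. c \<in> {1..k} \<Longrightarrow> {l. (l, c) \<in> set s} = snd (g c)"
    using frobenius_row_of_classes[of k "\<lambda>c. snd (g c)"] fin by blast
  have "color_split k (r, s) = g"
  proof (rule extensionalityI[of _ "{1..k}"])
    show "g \<in> extensional {1..k}"
      using g by (simp add: neutral_mayas_def PiE_iff)
    show "color_split k (r, s) c = g c" if "c \<in> {1..k}" for c
      using that r(2)[OF that] s(2)[OF that] by (simp add: color_split_def)
  qed (simp add: color_split_def)
  moreover from this have "(r, s) \<in> frobenius_symbols k"
    using r(1) s(1) charge_color_split[OF r(1) s(1)] g
    by (simp add: frobenius_symbols_def neutral_mayas_def)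
  ultimately show "g \<in> color_split k ` frobenius_symbols k"
    by (metis imageI)
qed

lemma frobenius_size_color_split:
  assumes "F \<in> frobenius_symbols k"
  shows "frobenius_size F = (\<Sum>c\<in>{1..k}. energy (color_split k F c))"
proof -
  have F: "frobenius_row k (fst F)" "frobenius_row k (snd F)"
    using assms by (auto simp: frobenius_symbols_def)
  have "(\<Sum>c\<in>{1..k}. energy (color_split k F c)) =
      sum_list (map (\<lambda>x. Suc (fst x)) (fst F)) + sum_list (map fst (snd F))"
    using sum_list_frobenius_row[OF F(1), of Suc] sum_list_frobenius_row[OF F(2), of "\<lambda>l. l"]
    by (simp add: color_split_def energy_def sum.distrib)
  then show ?thesis
    by (simp add: frobenius_size_def sum_list_Suc)
qed

section \<open>Separating the charges from the neutral diagrams\<close>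

lemma bij_betw_neutral_translate:
  "bij_betw (\<lambda>(m, p). \<lambda>c\<in>{1..k}. translate (m c) (p c))
     (neutral_charges k \<times> PiE {1..k} (\<lambda>_. sector 0)) (neutral_mayas k)"
  (is "bij_betw ?f ?A ?B")
proof -
  let ?f' = "\<lambda>g. (\<lambda>c\<in>{1..k}. charge (g c), \<lambda>c\<in>{1..k}. translate (- charge (g c)) (g c))"
  have ch: "translate m p \<in> mayas" "charge (translate m p) = m" if "p \<in> sector 0" for m p
    using translate_sector[OF that, of m] by (auto simp: sector_def)
  have 1: "\<forall>a\<in>?A. ?f' (?f a) = a"
    by (auto simp: neutral_charges_def PiE_iff ch translate_inverse extensional_def
        restrict_def fun_eq_iff)
  have 2: "\<forall>g\<in>?B. ?f (?f' g) = g"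
    using translate_inverse[of "- _"]
    by (auto simp: neutral_mayas_def PiE_iff extensional_def restrict_def fun_eq_iff)
  have 3: "?f ` ?A \<subseteq> ?B"
    by (auto simp: neutral_charges_def neutral_mayas_def PiE_iff ch)
  have 0: "translate (- charge p) p \<in> sector 0" if "p \<in> mayas" for p
    using translate_sector[of p "charge p" "- charge p"] that by (simp add: sector_def)
  have 4: "?f' ` ?B \<subseteq> ?A"
    by (auto simp: neutral_charges_def neutral_mayas_def PiE_iff intro!: 0)
  show ?thesis
    using 1 2 3 4 by (rule bij_betw_byWitness)
qed

text \<open>Once the charges are split off, the neutral diagrams of the \<open>k\<close> colours are
  independent, and each contributes a factor \<open>1 / qpoch_inf q q\<close>. Only the charges
  remain coupled, through their vanishing sum.\<close>

lemma has_sum_frobenius_symbols: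
  fixes q :: complex
  assumes q: "norm q < 1" and S: "((\<lambda>m. \<Prod>c\<in>{1..k}. q ^ triangular (m c)) has_sum S) (neutral_charges k)"
  shows "((\<lambda>F. q ^ frobenius_size F) has_sum (S / qpoch_inf q q ^ k)) (frobenius_symbols k)"
proof -
  have "((\<lambda>p. \<Prod>c\<in>{1..k}. q ^ energy (p c)) has_sum (\<Prod>c\<in>{1..k}. 1 / qpoch_inf q q))
      (PiE {1..k} (\<lambda>_. sector 0))"
    by (intro has_sum_prod_PiE has_sum_sector_0 q) simp
  then have "((\<lambda>(m, p). (\<Prod>c\<in>{1..k}. q ^ triangular (m c)) * (\<Prod>c\<in>{1..k}. q ^ energy (p c)))
      has_sum S * (\<Prod>c\<in>{1..k}. 1 / qpoch_inf q q))
      (neutral_charges k \<times> PiE {1..k} (\<lambda>_. sector 0))"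
    by (intro has_sum_Times_mult S)
  also have "S * (\<Prod>c\<in>{1..k}. 1 / qpoch_inf q q) = S / qpoch_inf q q ^ k"
    by (simp add: field_simps)
  also have "((\<lambda>(m, p). (\<Prod>c\<in>{1..k}. q ^ triangular (m c)) * (\<Prod>c\<in>{1..k}. q ^ energy (p c)))
        has_sum (S / qpoch_inf q q ^ k)) (neutral_charges k \<times> PiE {1..k} (\<lambda>_. sector 0)) \<longleftrightarrow>
      ((\<lambda>g. q ^ (\<Sum>c\<in>{1..k}. energy (g c))) has_sum (S / qpoch_inf q q ^ k)) (neutral_mayas k)"
    by (subst has_sum_reindex_bij_betw[OF bij_betw_neutral_translate, symmetric])
      (auto intro!: has_sum_cong prod.cong
        simp: energy_translate power_sum power_add PiE_iff mult.commute simp flip: prod.distrib)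
  also have "\<dots> \<longleftrightarrow> ((\<lambda>F. q ^ frobenius_size F) has_sum (S / qpoch_inf q q ^ k)) (frobenius_symbols k)"
    by (subst has_sum_reindex_bij_betw[OF bij_betw_color_split, symmetric])
      (auto intro!: has_sum_cong simp: frobenius_size_color_split)
  finally show ?thesis .
qed

text \<open>Grouping the symbols by size gives finite fibres of \<open>cphi k n\<close> elements;
  the unconditional sum also yields convergence of the power series.\<close>

lemma cphi_sums:
  fixes q :: complex
  assumes "((\<lambda>F. q ^ frobenius_size F) has_sum S) (frobenius_symbols k)"
  shows "(\<lambda>n. of_nat (cphi k n) * q ^ n) sums S"
proof -
  have bij: "bij_betw snd (SIGMA n:UNIV. {F \<in> frobenius_symbols k. frobenius_size F = n})
      (frobenius_symbols k)"
    by (rule bij_betw_byWitness[where f' = "\<lambda>F. (frobenius_size F, F)"]) auto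
  have "((\<lambda>p. q ^ frobenius_size (snd p)) has_sum S)
      (SIGMA n:UNIV. {F \<in> frobenius_symbols k. frobenius_size F = n})"
    using assms by (subst has_sum_reindex_bij_betw[OF bij])
  then have "((\<lambda>n. of_nat (cphi k n) * q ^ n) has_sum S) UNIV"
  proof (rule has_sum_Sigma')
    fix n
    have "(\<Sum>F | F \<in> frobenius_symbols k \<and> frobenius_size F = n. q ^ frobenius_size F) =
        (\<Sum>F | F \<in> frobenius_symbols k \<and> frobenius_size F = n. q ^ n)"
      by (rule sum.cong) auto
    then have "of_nat (cphi k n) * q ^ n =
        (\<Sum>F | F \<in> frobenius_symbols k \<and> frobenius_size F = n. q ^ frobenius_size F)"
      by (simp only: cphi_def sum_constant)
    then show "((\<lambda>F. q ^ frobenius_size (snd (n, F))) has_sum of_nat (cphi k n) * q ^ n)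
        {F \<in> frobenius_symbols k. frobenius_size F = n}"
      unfolding snd_conv by (intro has_sum_finiteI finite_frobenius_symbols_of_size)
  qed
  then show ?thesis
    by (rule has_sum_imp_sums)
qed

section \<open>Theta series\<close>

text \<open>With squares as naturals the theta terms become ordinary powers instead of
  \<open>powi\<close>.\<close>

definition sq :: "int \<Rightarrow> nat" where
  "sq j = nat (j\<^sup>2)"

lemma int_sq [simp]: "int (sq j) = j\<^sup>2"
  by (simp add: sq_def)

lemma powi_square: "x powi (j\<^sup>2) = x ^ sq j"
  by (simp add: sq_def power_int_def)

text \<open>Since \<open>\<bar>j\<bar> \<le> j\<^sup>2\<close>, the two-sided geometric series
  dominates.\<close>

lemma summable_on_power_sq:
  fixes x :: complex
  assumes "norm x < 1"
  shows "(\<lambda>j. x ^ sq j) summable_on A"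
proof -
  have nat: "(\<lambda>n::nat. norm x ^ n) summable_on UNIV"
    using assms by (intro summable_nonneg_imp_summable_on summable_geometric) auto
  have "(\<lambda>j::int. norm x ^ nat \<bar>j\<bar>) summable_on range int"
    by (subst summable_on_reindex) (use nat in \<open>auto simp: o_def\<close>)
  moreover have "(\<lambda>j::int. norm x ^ nat \<bar>j\<bar>) summable_on range (\<lambda>n. - int n)"
    by (subst summable_on_reindex) (use nat in \<open>auto simp: o_def inj_on_def\<close>)
  ultimately have "(\<lambda>j::int. norm x ^ nat \<bar>j\<bar>) summable_on (range int \<union> range (\<lambda>n. - int n))"
    by (rule summable_on_union)
  moreover have "range int \<union> range (\<lambda>n. - int n) = UNIV"
    by (auto simp: image_iff) (metis int_cases2)
  ultimately have "(\<lambda>j::int. norm x ^ nat \<bar>j\<bar>) summable_on UNIV" by simp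
  then have "(\<lambda>j. norm (x ^ sq j)) summable_on UNIV"
  proof (rule Infinite_Sum.abs_summable_on_comparison_test')
    fix j :: int
    have "\<bar>j\<bar> * 1 \<le> \<bar>j\<bar> * \<bar>j\<bar>"
      by (cases "j = 0") (simp, intro mult_left_mono, auto)
    then have "\<bar>j\<bar> \<le> j\<^sup>2"
      by (simp add: power2_eq_square)
    then show "norm (x ^ sq j) \<le> norm x ^ nat \<bar>j\<bar>"
      using assms by (auto simp: norm_power sq_def intro!: power_decreasing nat_mono)
  qed
  then have "(\<lambda>j. x ^ sq j) summable_on UNIV"
    by (rule abs_summable_summable)
  then show ?thesis
    by (rule summable_on_subset_banach) simp
qed

lemma has_sum_Theta3:
  "norm x < 1 \<Longrightarrow> ((\<lambda>j. x ^ sq j) has_sum Theta3 x) UNIV"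
  using summable_on_power_sq[of x UNIV] by (simp add: Theta3_def powi_square)

text \<open>For a square root \<open>s\<close> of \<open>q\<close>, the even and odd parts of the
  theta series in \<open>s\<close> are the two theta values at \<open>q\<^sup>2\<close>.\<close>

lemma has_sum_even_squares:
  assumes "norm s < 1"
  shows "((\<lambda>j. s ^ sq j) has_sum Theta3 (s ^ 4)) {j. even j}"
proof -
  have bij: "bij_betw ((*) 2) (UNIV :: int set) {j. even j}"
    by (rule bij_betw_byWitness[where f' = "\<lambda>j. j div 2"]) auto
  have "norm (s ^ 4) < 1"
    using assms by (simp add: norm_power power_less_one_iff)
  then have "((\<lambda>j. (s ^ 4) ^ sq j) has_sum Theta3 (s ^ 4)) UNIV"
    by (rule has_sum_Theta3)
  moreover have "sq (2 * j) = 4 * sq j" for j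
    by (simp add: sq_def power2_eq_square nat_mult_distrib)
  ultimately have "((\<lambda>j. s ^ sq (2 * j)) has_sum Theta3 (s ^ 4)) UNIV"
    by (simp add: power_mult)
  then show ?thesis
    by (subst (asm) has_sum_reindex_bij_betw[OF bij])
qed

lemma has_sum_odd_squares:
  assumes "norm s < 1"
  shows "((\<lambda>j. s ^ sq j) has_sum Theta2_root s) {j. odd j}"
proof -
  have bij: "bij_betw (\<lambda>j. 2 * j + 1) (UNIV :: int set) {j. odd j}"
    by (rule bij_betw_byWitness[where f' = "\<lambda>j. j div 2"]) auto
  show ?thesis
    using summable_on_power_sq[OF assms, of "{j. odd j}"]
      infsum_reindex_bij_betw[OF bij, of "\<lambda>j. s ^ sq j"]
    by (simp add: Theta2_root_def powi_square has_sum_iff)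
qed

text \<open>Two integers with even sum are both even or both odd. The sign on the odd pairs treats
  the arguments \<open>q\<close> and \<open>- q\<close> together.\<close>

lemma has_sum_signed_parity_pairs:
  fixes \<epsilon> :: complex
  assumes s: "norm s < 1"
  shows "((\<lambda>(x, y). (if even x then 1 else \<epsilon>) * s ^ (sq x + sq y))
    has_sum Theta3 (s ^ 4) ^ 2 + \<epsilon> * Theta2_root s ^ 2) {(x, y). even (x + y)}"
proof -
  note e = has_sum_even_squares[OF s] and o = has_sum_odd_squares[OF s]
  let ?f = "\<lambda>(x, y). (if even x then 1 else \<epsilon>) * s ^ (sq x + sq y)"
  have "(?f has_sum Theta3 (s ^ 4) * Theta3 (s ^ 4)) ({x. even x} \<times> {y. even y})"
    using has_sum_Times_mult[OF e e] by (rule has_sum_cong[THEN iffD1, rotated]) (auto simp: power_add)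
  moreover have "(?f has_sum \<epsilon> * (Theta2_root s * Theta2_root s)) ({x. odd x} \<times> {y. odd y})"
    using has_sum_cmult_right[OF has_sum_Times_mult[OF o o], of \<epsilon>]
    by (rule has_sum_cong[THEN iffD1, rotated]) (auto simp: power_add)
  ultimately have "(?f has_sum Theta3 (s ^ 4) * Theta3 (s ^ 4) + \<epsilon> * (Theta2_root s * Theta2_root s))
      ({x. even x} \<times> {y. even y} \<union> {x. odd x} \<times> {y. odd y})"
    by (rule has_sum_Un_disjoint) auto
  moreover have "{x. even x} \<times> {y. even y} \<union> {x. odd x} \<times> {y. odd y} = {(x, y :: int). even (x + y)}"
    by auto
  ultimately show ?thesis
    by (simp add: power2_eq_square)
qed

text \<open>An even sum means that none or exactly two of the three integers are odd, and the odd
  pair can be chosen in 3 ways.\<close>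

lemma has_sum_parity_triples:
  assumes s: "norm s < 1"
  shows "((\<lambda>(x, y, z). s ^ (sq x + sq y + sq z))
    has_sum Theta3 (s ^ 4) ^ 3 + 3 * Theta3 (s ^ 4) * Theta2_root s ^ 2) {(x, y, z). even (x + y + z)}"
proof -
  note e = has_sum_even_squares[OF s] and o = has_sum_odd_squares[OF s]
  let ?E = "{x :: int. even x}" and ?O = "{x :: int. odd x}"
  let ?e = "Theta3 (s ^ 4)" and ?o = "Theta2_root s"
  let ?f = "\<lambda>(x, y, z). s ^ (sq x + sq y + sq z)"
  have *: "(?f has_sum a * (b * c)) (A \<times> B \<times> C)"
    if "((\<lambda>j. s ^ sq j) has_sum a) A" "((\<lambda>j. s ^ sq j) has_sum b) B"
      "((\<lambda>j. s ^ sq j) has_sum c) C" for a b c A B C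
    using has_sum_Times_mult[OF that(1) has_sum_Times_mult[OF that(2,3)]]
    by (rule has_sum_cong[THEN iffD1, rotated]) (auto simp: power_add)
  have "(?f has_sum ?e * (?e * ?e) + ?e * (?o * ?o) + ?o * (?e * ?o) + ?o * (?o * ?e))
      (?E \<times> ?E \<times> ?E \<union> ?E \<times> ?O \<times> ?O \<union> ?O \<times> ?E \<times> ?O \<union> ?O \<times> ?O \<times> ?E)"
    by (intro has_sum_Un_disjoint * e o) auto
  moreover have "?E \<times> ?E \<times> ?E \<union> ?E \<times> ?O \<times> ?O \<union> ?O \<times> ?E \<times> ?O \<union> ?O \<times> ?O \<times> ?E =
      {(x, y, z). even (x + y + z)}"
    by auto
  ultimately show ?thesis
    by (simp add: power2_eq_square power3_eq_cube algebra_simps)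
qed

text \<open>The map (a, b) to (a + b, a - b) sends all pairs onto the pairs with even sum and
  doubles the sum of squares. The sign agrees because a^2 + b^2 and a + b have the same
  parity.\<close>

lemma Theta3_power2:
  assumes s: "norm s < 1" and \<epsilon>: "\<epsilon> = 1 \<or> \<epsilon> = - 1"
  shows "Theta3 (\<epsilon> * s\<^sup>2) ^ 2 = Theta3 (s ^ 4) ^ 2 + \<epsilon> * Theta2_root s ^ 2"
proof -
  have q: "norm (\<epsilon> * s\<^sup>2) < 1"
    using assms by (auto simp: norm_mult norm_power power_less_one_iff)
  let ?h = "\<lambda>(a, b). (a + b, a - b)"
  have bij: "bij_betw ?h (UNIV \<times> UNIV) {(x, y :: int). even (x + y)}"
    by (rule bij_betw_byWitness[where f' = "\<lambda>(x, y). ((x + y) div 2, (x - y) div 2)"];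
        auto; presburger)
  have \<epsilon>_power: "\<epsilon> ^ n = (if even n then 1 else \<epsilon>)" for n
    using \<epsilon> by (cases "even n") auto
  have ev: "even (sq a) \<longleftrightarrow> even a" for a
    by (metis int_sq even_of_nat even_power zero_less_numeral pos2)
  have "sq (a + b) + sq (a - b) = 2 * sq a + 2 * sq b" for a b
  proof -
    have "int (sq (a + b) + sq (a - b)) = int (2 * sq a + 2 * sq b)"
      by (simp add: power2_eq_square algebra_simps)
    then show ?thesis by linarith
  qed
  then have eq: "(if even (a + b) then 1 else \<epsilon>) * s ^ (sq (a + b) + sq (a - b)) =
      (\<epsilon> * s\<^sup>2) ^ sq a * (\<epsilon> * s\<^sup>2) ^ sq b" for a b
    using \<epsilon> by (auto simp: power_mult_distrib power_mult power_add \<epsilon>_power ev)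
  have "((\<lambda>(a, b). (\<epsilon> * s\<^sup>2) ^ sq a * (\<epsilon> * s\<^sup>2) ^ sq b)
      has_sum Theta3 (s ^ 4) ^ 2 + \<epsilon> * Theta2_root s ^ 2) (UNIV \<times> UNIV)"
    using has_sum_signed_parity_pairs[OF s, of \<epsilon>,
        unfolded has_sum_reindex_bij_betw[OF bij, symmetric]]
    by (simp only: case_prod_unfold fst_conv snd_conv eq)
  moreover have "((\<lambda>(a, b). (\<epsilon> * s\<^sup>2) ^ sq a * (\<epsilon> * s\<^sup>2) ^ sq b)
      has_sum Theta3 (\<epsilon> * s\<^sup>2) * Theta3 (\<epsilon> * s\<^sup>2)) (UNIV \<times> UNIV)"
    by (intro has_sum_Times_mult has_sum_Theta3 q)
  ultimately have "Theta3 (s ^ 4) ^ 2 + \<epsilon> * Theta2_root s ^ 2 = Theta3 (\<epsilon> * s\<^sup>2) * Theta3 (\<epsilon> * s\<^sup>2)"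
    by (rule has_sum_unique)
  then show ?thesis
    by (simp only: power2_eq_square)
qed

lemma Theta3_nonzero:
  assumes x: "norm x < 1"
  shows "Theta3 x \<noteq> 0"
proof -
  \<comment> \<open>Weighting \<open>(R, S)\<close> by \<open>2 energy - charge\<close> makes the roles of \<open>R\<close> and \<open>S\<close> symmetric, so that the
    generating function over all Maya diagrams is a square of a nonvanishing product.\<close>
  define P where "P = (\<Prod>n. 1 + x ^ (2 * n + 1))"
  define v :: "maya \<Rightarrow> nat" where "v = (\<lambda>(R, S). (\<Sum>l\<in>R. 2 * l + 1) + (\<Sum>l\<in>S. 2 * l + 1))"
  have x2: "norm (x\<^sup>2) < 1"
    using x by (simp add: norm_power power_less_one_iff)
  have "P \<noteq> 0"
    unfolding P_def using x
    by (intro prodinf_one_plus_nonzero summable_norm_power_linear)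
      (auto simp: norm_power norm_mult power_less_one_iff simp del: power_Suc)
  have R: "((\<lambda>R. x ^ (\<Sum>l\<in>R. 2 * l + 1)) has_sum P) {R. finite R}"
    unfolding P_def by (rule has_sum_finite_subsets_power[OF x]) simp
  have "((\<lambda>p. x ^ v p) has_sum P * P) mayas"
    using has_sum_Times_mult[OF R R]
    by (simp add: mayas_def v_def power_add case_prod_unfold)
  then have 1: "((\<lambda>(m, p). x ^ v (translate m p)) has_sum P * P) (UNIV \<times> sector 0)"
    by (subst (asm) has_sum_reindex_bij_betw[OF bij_betw_translate, symmetric])
      (simp add: case_prod_unfold)
  have v: "int (v p) = 2 * int (energy p) - charge p" for p
    by (cases p) (simp add: v_def energy_def charge_def sum_distrib_left sum.distrib)
  \<comment> \<open>The charge turns \<open>2 * triangular m\<close> into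
    \<open>m * (m + 1) - m\<close>, a pure square.\<close>
  have "v (translate m p) = 2 * energy p + sq m" if "p \<in> sector 0" for m p
  proof -
    have "charge (translate m p) = m"
      using translate_sector[OF that, of m] by (simp add: sector_def)
    then have "int (v (translate m p)) = int (2 * energy p + sq m)"
      using two_triangular[of m] by (simp add: v energy_translate[OF that] power2_eq_square algebra_simps)
    then show ?thesis by linarith
  qed
  then have eq: "x ^ v (translate m p) = x ^ sq m * (x\<^sup>2) ^ energy p" if "p \<in> sector 0" for m p
    using that by (simp add: power_add mult.commute flip: power_mult)
  have "((\<lambda>(m, p). x ^ sq m * (x\<^sup>2) ^ energy p) has_sum Theta3 x * (1 / qpoch_inf (x\<^sup>2) (x\<^sup>2)))
      (UNIV \<times> sector 0)"
    by (intro has_sum_Times_mult has_sum_Theta3 has_sum_sector_0 x x2)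
  then have "((\<lambda>(m, p). x ^ v (translate m p)) has_sum Theta3 x * (1 / qpoch_inf (x\<^sup>2) (x\<^sup>2)))
      (UNIV \<times> sector 0)"
    by (rule has_sum_cong[THEN iffD1, rotated]) (auto simp: eq)
  \<comment> \<open>This is the Jacobi triple product with its second variable equal to 1: one
    family summed in two ways.\<close>
  with 1 have "Theta3 x * (1 / qpoch_inf (x\<^sup>2) (x\<^sup>2)) = P * P"
    using has_sum_unique by blast
  with \<open>P \<noteq> 0\<close> show ?thesis by auto
qed

section \<open>The coincidence of the lattices \<open>A_3\<close> and \<open>D_3\<close>\<close>

lemma bij_betw_neutral_charges_4:
  "bij_betw (\<lambda>m. (m 1 + m 2, m 2 + m 3, m 1 + m 3)) (neutral_charges 4)
    {(x, y, z :: int). even (x + y + z)}"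
  (is "bij_betw ?f ?A ?B")
proof -
  \<comment> \<open>Half the sum of the three pairwise sums is
    \<open>t = m 1 + m 2 + m 3 = - m 4\<close>; subtracting one pairwise sum from \<open>t\<close>
    leaves the remaining charge.\<close>
  let ?f' = "\<lambda>(x, y, z). \<lambda>c\<in>{1..4::nat}. let t = (x + y + z) div 2 in
    if c = 1 then t - y else if c = 2 then t - z else if c = 3 then t - x else - t"
  have I: "{Suc 0..4} = {Suc 0, 2, 3, 4}" by auto
  have 1: "?f' (?f m) = m" if "m \<in> ?A" for m
  proof -
    have "m 4 = - (m 1 + m 2 + m 3)"
      using that by (simp add: neutral_charges_def I)
    moreover have "m c = undefined" if "c \<notin> {1..4}" for c
      using that \<open>m \<in> ?A\<close> by (auto simp: neutral_charges_def PiE_iff extensional_def)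
    moreover have "(m 1 + m 2 + (m 2 + m 3) + (m 1 + m 3)) div 2 = m 1 + m 2 + m 3"
      by simp
    ultimately show ?thesis
      by (auto simp: fun_eq_iff I Let_def)
  qed
  have 2: "?f (?f' a) = a" and 3: "?f' a \<in> ?A" if "a \<in> ?B" for a
  proof -
    obtain x y z where a: "a = (x, y, z)" by (cases a)
    then have "2 * ((x + y + z) div 2) = x + y + z"
      using that by simp
    then show "?f (?f' a) = a" "?f' a \<in> ?A"
      unfolding a by (simp_all add: neutral_charges_def I Let_def)
  qed
  show ?thesis
  proof (rule bij_betw_byWitness[where f' = ?f'])
    show "\<forall>m\<in>?A. ?f' (?f m) = m" by (intro ballI 1)
    show "\<forall>a\<in>?B. ?f (?f' a) = a" by (intro ballI 2)
    show "?f ` ?A \<subseteq> ?B" by auto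
    show "?f' ` ?B \<subseteq> ?A" by (intro image_subsetI 3)
  qed
qed

text \<open>As the charges add up to 0, twice the sum of their triangular numbers is the sum of
  their squares. Eliminating \<open>m 4\<close> turns this into the sum of the squares of
  \<open>m 1 + m 2\<close>, \<open>m 2 + m 3\<close> and \<open>m 1 + m 3\<close>.\<close>

lemma has_sum_neutral_charges_4:
  assumes s: "norm s < 1"
  shows "((\<lambda>m. \<Prod>c\<in>{1..4}. (s\<^sup>2) ^ triangular (m c))
    has_sum Theta3 (s ^ 4) ^ 3 + 3 * Theta3 (s ^ 4) * Theta2_root s ^ 2) (neutral_charges 4)"
proof -
  have I: "{Suc 0..4} = {Suc 0, 2, 3, 4}" by auto
  have eq: "s ^ (sq (m 1 + m 2) + sq (m 2 + m 3) + sq (m 1 + m 3)) =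
      (\<Prod>c\<in>{1..4}. (s\<^sup>2) ^ triangular (m c))" if "m \<in> neutral_charges 4" for m
  proof -
    have "m 1 + m 2 + m 3 + m 4 = 0"
      using that by (simp add: neutral_charges_def I add.assoc)
    then have m4: "m 4 = - (m 1 + m 2 + m 3)" by simp
    have "int (sq (m 1 + m 2) + sq (m 2 + m 3) + sq (m 1 + m 3)) =
        int (\<Sum>c\<in>{1..4}. 2 * triangular (m c))"
      by (simp add: I two_triangular m4 power2_eq_square algebra_simps)
    then have "sq (m 1 + m 2) + sq (m 2 + m 3) + sq (m 1 + m 3) = (\<Sum>c\<in>{1..4}. 2 * triangular (m c))"
      by (simp only: of_nat_eq_iff)
    then show ?thesis
      by (simp add: power_sum power_mult)
  qed
  show ?thesis
    using has_sum_parity_triples[OF s,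
        unfolded has_sum_reindex_bij_betw[OF bij_betw_neutral_charges_4, symmetric]]
    by (rule has_sum_cong[THEN iffD1, rotated]) (simp only: eq prod.case)
qed

theorem theorem6p1:
  fixes q s :: complex
  assumes "norm q < 1" and "s\<^sup>2 = q"
  shows "summable (\<lambda>n. of_nat (cphi 4 n) * q ^ n) \<and>
         CPhi 4 q =
           1 / qpoch_inf q q ^ 4 *
             (Theta3 (q\<^sup>2) ^ 3 + 3 * Theta3 (q\<^sup>2) * Theta2_root s ^ 2) \<and>
         1 / qpoch_inf q q ^ 4 *
             (Theta3 (q\<^sup>2) ^ 3 + 3 * Theta3 (q\<^sup>2) * Theta2_root s ^ 2) =
           Theta3 q ^ 4 / (qpoch_inf q q ^ 4 * Theta3 (q\<^sup>2)) +
             Theta3 (- q) ^ 2 * Theta2_root s ^ 2 / (qpoch_inf q q ^ 4 * Theta3 (q\<^sup>2))"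
proof -
  have s: "norm s < 1"
    using assms by (metis norm_ge_zero norm_power power_less_one_iff pos2)
  have s4: "s ^ 4 = q\<^sup>2"
    unfolding assms(2)[symmetric] by (simp flip: power_mult)
  have sums: "(\<lambda>n. of_nat (cphi 4 n) * q ^ n) sums
      ((Theta3 (q\<^sup>2) ^ 3 + 3 * Theta3 (q\<^sup>2) * Theta2_root s ^ 2) / qpoch_inf q q ^ 4)"
    using has_sum_neutral_charges_4[OF s] unfolding s4 assms(2)
    by (intro cphi_sums has_sum_frobenius_symbols assms(1))
  have "norm (q\<^sup>2) < 1"
    using assms(1) by (simp add: norm_power power_less_one_iff)
  then have nz: "Theta3 (q\<^sup>2) \<noteq> 0"
    by (rule Theta3_nonzero)
  have plus: "Theta3 q ^ 2 = Theta3 (q\<^sup>2) ^ 2 + Theta2_root s ^ 2"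
    and minus: "Theta3 (- q) ^ 2 = Theta3 (q\<^sup>2) ^ 2 - Theta2_root s ^ 2"
    using Theta3_power2[OF s, of 1] Theta3_power2[OF s, of "-1"] by (simp_all add: s4 assms(2))
  have "Theta3 q ^ 4 + Theta3 (- q) ^ 2 * Theta2_root s ^ 2 =
      (Theta3 q ^ 2) ^ 2 + Theta3 (- q) ^ 2 * Theta2_root s ^ 2"
    by simp
  \<comment> \<open>With A = \<open>Theta3 (q\<^sup>2)\<close> and B = \<open>Theta2_root s\<close>
    this reads (A^2 + B^2)^2 + (A^2 - B^2) B^2 = A (A^3 + 3 A B^2).\<close>
  also have "\<dots> = Theta3 (q\<^sup>2) * (Theta3 (q\<^sup>2) ^ 3 + 3 * Theta3 (q\<^sup>2) * Theta2_root s ^ 2)"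
    unfolding plus minus by algebra
  finally have "Theta3 q ^ 4 + Theta3 (- q) ^ 2 * Theta2_root s ^ 2 =
      Theta3 (q\<^sup>2) * (Theta3 (q\<^sup>2) ^ 3 + 3 * Theta3 (q\<^sup>2) * Theta2_root s ^ 2)" .
  then show ?thesis
    using sums nz qpoch_inf_nonzero[OF assms(1)]
    by (simp add: sums_iff CPhi_def flip: add_divide_distrib)
qed

end
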